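(* For any real $x\ge4$, there is always a lucky number in the interval $[x,2x]$.
   Context: Lucky numbers: let $A_0=\mathbb N=\{1,2,3,\dots\}$. Remove every second element of $A_0$ to get $A_1=\{1,3,5,7,\dots\}$. Take the next remaining number, $3$, and remove every third element of $A_1$ (in increasing order) to get $A_2=\{1,3,7,9,13,\dots\}$. Take the next remaining number, $7$, and remove every seventh element of $A_2$ to get $A_3$, and so on. The set of lucky numbers is $A_\infty=\bigcap_i A_i=\{1,3,7,9,13,15,21,25,31,33,\dots\}$. *)

theory Defs
  imports Complex_Main
begin

text \<open>The position of \<open>n\<close> in \<open>A\<close>, listed in increasing order and counted from 1, is
  \<open>card {m \<in> A. m \<le> n}\<close>.\<close>

definition remove_every :: "nat \<Rightarrow> nat set \<Rightarrow> nat set" where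
  "remove_every k A = {n \<in> A. \<not> k dvd card {m \<in> A. m \<le> n}}"

text \<open>Stage \<open>i\<close> of the sieve is the pair of the set \<open>A\<^sub>i\<close> and the number \<open>s\<^sub>i\<close> such that every
  \<open>s\<^sub>i\<close>-th element of \<open>A\<^sub>i\<close> is removed to obtain \<open>A\<^sub>i\<^sub>+\<^sub>1\<close>. The next \<open>s\<close> is the smallest
  remaining number beyond the previous one: \<open>2, 3, 7, 9, 13, \<dots>\<close>.\<close>

primrec lucky_stage :: "nat \<Rightarrow> nat set \<times> nat" where
  "lucky_stage 0 = ({1..}, 2)"
| "lucky_stage (Suc i) =
     (let (A, s) = lucky_stage i; A' = remove_every s A
      in (A', LEAST n. n \<in> A' \<and> s < n))"

definition lucky_sieve :: "nat \<Rightarrow> nat set" where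
  "lucky_sieve i = fst (lucky_stage i)"

definition lucky_numbers :: "nat set" where
  "lucky_numbers = (\<Inter>i. lucky_sieve i)"

end

theory Submission imports Defs begin

text \<open>
  Let \<open>u < v\<close> be consecutive elements of a late stage \<open>A\<^sub>i\<close>, at positions \<open>m\<close> and \<open>m + 1\<close> (counted
  from 0), and follow their positions \<open>a\<^sub>j, b\<^sub>j\<close> back through the earlier stages \<open>A\<^sub>j\<close>. Undoing a
  step with \<open>s > m + 2\<close> changes neither position. Undoing a step with \<open>s \<le> c + 2\<close> preserves an
  inequality \<open>b + c \<le> 2 a\<close>, because the residues of the positions of surviving elements modulo \<open>s\<close>
  are at most \<open>s - 2\<close>. The inequality holds for \<open>c = m - 1\<close> at the outset, and at worst for
  \<open>c = m - 2\<close> if \<open>s = m + 2\<close> occurs; in that case all earlier \<open>s\<close> are at most \<open>m\<close>, since the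
  numbers \<open>s\<close> other than 2 are odd. At stage 0, where the positions are \<open>u - 1\<close> and \<open>v - 1\<close>, this
  gives \<open>v \<le> 2 u\<close>. If \<open>s\<^sub>i\<close> is large enough, then \<open>u\<close> and \<open>v\<close> are lucky.
\<close>

section \<open>Positions\<close>

text \<open>Counted from 0 and meaningful also outside \<open>A\<close>. For
  \<open>n \<in> A\<close>, the position that \<open>remove_every\<close> tests is
  \<open>Suc (pos A n)\<close>.\<close>

definition pos :: "nat set \<Rightarrow> nat \<Rightarrow> nat" where
  "pos A n = card {m \<in> A. m < n}"

lemma pos_0 [simp]: "pos A 0 = 0"
  by (simp add: pos_def)

lemma pos_Suc: "pos A (Suc n) = (if n \<in> A then Suc (pos A n) else pos A n)"
proof (cases "n \<in> A")
  case True
  then have "{m \<in> A. m < Suc n} = insert n {m \<in> A. m < n}"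
    by auto
  then show ?thesis
    using True by (simp add: pos_def)
next
  case False
  then have "{m \<in> A. m < Suc n} = {m \<in> A. m < n}"
    by (auto simp: less_Suc_eq)
  then show ?thesis
    using False by (simp add: pos_def)
qed

lemma pos_atLeast_1: "pos {Suc 0..} n = n - 1"
  by (induction n) (auto simp: pos_Suc)

lemma pos_next:
  assumes "u \<in> A" "u < v" "\<And>w. w \<in> A \<Longrightarrow> w < v \<Longrightarrow> w \<le> u"
  shows "pos A v = Suc (pos A u)"
proof -
  have "{m \<in> A. m < v} = insert u {m \<in> A. m < u}"
    using assms by (auto simp: le_less)
  then show ?thesis
    by (simp add: pos_def)
qed

lemma mem_remove_every_iff:
  "n \<in> remove_every k A \<longleftrightarrow> n \<in> A \<and> \<not> k dvd Suc (pos A n)"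
  using pos_Suc[of A n] by (auto simp: remove_every_def pos_def less_Suc_eq_le)

lemma pos_remove_every: "pos (remove_every k A) n = pos A n - pos A n div k"
proof (induction n)
  case (Suc n)
  have "pos A n div k \<le> pos A n"
    by simp
  with Suc show ?case
    by (auto simp: pos_Suc mem_remove_every_iff div_Suc dvd_eq_mod_eq_0 Suc_diff_le)
qed simp

text \<open>Two consecutive positions are not both divisible by \<open>k\<close>, so of two
  consecutive elements beyond \<open>N\<close> at least one survives.\<close>

lemma remove_every_unbounded:
  assumes "k \<ge> 2" and unbounded: "\<And>N. \<exists>n\<in>A. N < n"
  shows "\<exists>n\<in>remove_every k A. N < n"
proof -
  obtain u where u: "u \<in> A" "N < u"
    using unbounded by blast
  define v where "v = (LEAST n. n \<in> A \<and> u < n)"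
  have v: "v \<in> A \<and> u < v"
    unfolding v_def by (rule LeastI_ex) (use unbounded[of u] in blast)
  have "pos A v = Suc (pos A u)"
  proof (rule pos_next)
    fix w assume "w \<in> A" "w < v"
    then show "w \<le> u"
      using not_less_Least[of w "\<lambda>n. n \<in> A \<and> u < n"] unfolding v_def by auto
  qed (use u v in auto)
  moreover have "\<not> (k dvd Suc (pos A u) \<and> k dvd Suc (Suc (pos A u)))"
  proof
    assume "k dvd Suc (pos A u) \<and> k dvd Suc (Suc (pos A u))"
    then have "k dvd Suc (Suc (pos A u)) - Suc (pos A u)"
      using dvd_diff_nat by blast
    with \<open>k \<ge> 2\<close> show False
      by simp
  qed
  ultimately show ?thesis
    using u v by (auto simp: mem_remove_every_iff intro: less_trans)
qed

text \<open>Write \<open>p = q * s + r\<close>. Survival excludes \<open>r = s - 1\<close>, so the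
  new position \<open>q * (s - 1) + r\<close> still determines \<open>q\<close>, through division by
  \<open>s - 1\<close>.\<close>

lemma position_before_removal:
  fixes p s :: nat
  assumes "s \<ge> 2" "\<not> s dvd Suc p"
  shows "p = (p - p div s) + (p - p div s) div (s - 1)"
proof -
  define q r where "q = p div s" and "r = p mod s"
  obtain t where t: "s = Suc t"
    using \<open>s \<ge> 2\<close> by (cases s) auto
  have p: "p = q * t + r + q"
    using div_mult_mod_eq[of p s] by (simp add: q_def r_def t algebra_simps)
  have "Suc r \<noteq> s" "r < s"
    using assms by (auto simp: r_def mod_Suc dvd_eq_mod_eq_0)
  then have "r < t"
    using t by simp
  have "p - p div s = q * t + r"
    using p unfolding q_def[symmetric] by linarith
  then show ?thesis
    using p t \<open>r < t\<close> by simp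
qed

text \<open>Here \<open>t\<close> stands for \<open>s - 1\<close>. With \<open>q = a div t\<close>,
  the bounds \<open>a < (q + 1) * t\<close> and \<open>c \<ge> t - 1\<close> give
  \<open>b < (2 * q + 1) * t\<close>. So \<open>b\<close> gains at most \<open>2 * q\<close>, twice
  the gain of \<open>a\<close>.\<close>

lemma double_bound_before_removal:
  fixes a b c t :: nat
  assumes "t > 0" "t \<le> Suc c" and bound: "b + c \<le> 2 * a"
  shows "b + b div t + c \<le> 2 * (a + a div t)"
proof -
  have "a < Suc (a div t) * t"
    using \<open>t > 0\<close> by (simp add: dividend_less_div_times add.commute)
  then have "b < (2 * (a div t) + 1) * t"
    using assms by (simp add: algebra_simps)
  then have "b div t < 2 * (a div t) + 1"
    using \<open>t > 0\<close> by (simp only: div_less_iff_less_mult)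
  then show ?thesis
    using bound by simp
qed

section \<open>The sieve\<close>

definition lucky_step :: "nat \<Rightarrow> nat" where
  "lucky_step i = snd (lucky_stage i)"

lemma lucky_sieve_0: "lucky_sieve 0 = {1..}"
  and lucky_step_0: "lucky_step 0 = 2"
  by (simp_all add: lucky_sieve_def lucky_step_def)

lemma lucky_sieve_Suc: "lucky_sieve (Suc i) = remove_every (lucky_step i) (lucky_sieve i)"
  by (simp add: lucky_sieve_def lucky_step_def Let_def split: prod.split)

lemma lucky_step_Suc:
  "lucky_step (Suc i) = (LEAST n. n \<in> lucky_sieve (Suc i) \<and> lucky_step i < n)"
  by (simp add: lucky_sieve_def lucky_step_def Let_def split: prod.split)

lemma lucky_sieve_antimono: "i \<le> j \<Longrightarrow> lucky_sieve j \<subseteq> lucky_sieve i"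
  by (induction j rule: dec_induct) (auto simp: lucky_sieve_Suc mem_remove_every_iff)

text \<open>A joint induction: a step of at least 2 keeps the next stage unbounded, and
  unboundedness makes the next \<open>LEAST\<close> exist.\<close>

lemma lucky_sieve_unbounded_and_step_ge_2:
  "(\<forall>N. \<exists>n\<in>lucky_sieve i. N < n) \<and> lucky_step i \<ge> 2"
proof (induction i)
  case 0
  have "\<exists>n\<in>lucky_sieve 0. N < n" for N
    by (rule bexI[of _ "Suc N"]) (auto simp: lucky_sieve_0)
  then show ?case
    by (simp add: lucky_step_0)
next
  case (Suc i)
  have unbounded: "\<exists>n\<in>lucky_sieve (Suc i). N < n" for N
    unfolding lucky_sieve_Suc by (rule remove_every_unbounded) (use Suc in auto)
  have "lucky_step (Suc i) \<in> lucky_sieve (Suc i) \<and> lucky_step i < lucky_step (Suc i)"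
    unfolding lucky_step_Suc by (rule LeastI_ex) (use unbounded in blast)
  then show ?case
    using unbounded Suc by auto
qed

lemma lucky_sieve_unbounded: "\<exists>n\<in>lucky_sieve i. N < n"
  and lucky_step_ge_2: "lucky_step i \<ge> 2"
  using lucky_sieve_unbounded_and_step_ge_2 by blast+

lemma lucky_step_Suc_mem: "lucky_step (Suc i) \<in> lucky_sieve (Suc i)"
  and lucky_step_less_Suc: "lucky_step i < lucky_step (Suc i)"
proof -
  have "lucky_step (Suc i) \<in> lucky_sieve (Suc i) \<and> lucky_step i < lucky_step (Suc i)"
    unfolding lucky_step_Suc by (rule LeastI_ex) (use lucky_sieve_unbounded in blast)
  then show "lucky_step (Suc i) \<in> lucky_sieve (Suc i)" "lucky_step i < lucky_step (Suc i)"
    by auto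
qed

lemma strict_mono_lucky_step: "strict_mono lucky_step"
  by (simp add: strict_mono_Suc_iff lucky_step_less_Suc)

lemma lucky_sieve_1: "lucky_sieve (Suc 0) = {n. odd n}"
proof (rule set_eqI)
  show "n \<in> lucky_sieve (Suc 0) \<longleftrightarrow> n \<in> {n. odd n}" for n
    by (cases n) (auto simp: lucky_sieve_Suc mem_remove_every_iff lucky_sieve_0 lucky_step_0
        pos_atLeast_1)
qed

lemma odd_lucky_step:
  assumes "i > 0"
  shows "odd (lucky_step i)"
proof -
  obtain j where "i = Suc j"
    using assms by (cases i) auto
  then show ?thesis
    using lucky_step_Suc_mem[of j] lucky_sieve_antimono[of "Suc 0" i] lucky_sieve_1 by auto
qed

lemma pos_lucky_sieve_Suc:
  "pos (lucky_sieve (Suc i)) n =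
    pos (lucky_sieve i) n - pos (lucky_sieve i) n div lucky_step i"
  by (simp add: lucky_sieve_Suc pos_remove_every)

lemma pos_lucky_sieve_le: "pos (lucky_sieve i) n \<le> n - 1"
proof (induction i)
  case 0
  then show ?case by (simp add: lucky_sieve_0 pos_atLeast_1)
next
  case (Suc i)
  then show ?case by (simp add: pos_lucky_sieve_Suc)
qed

text \<open>Later removals never raise the position, while the steps grow; so the position, counted
  from 1, is never a multiple of the step.\<close>

lemma lucky_if_pos_less_step:
  assumes "n \<in> lucky_sieve i" "Suc (pos (lucky_sieve i) n) < lucky_step i"
  shows "n \<in> lucky_numbers"
proof -
  have later: "n \<in> lucky_sieve j \<and> Suc (pos (lucky_sieve j) n) < lucky_step j" if "i \<le> j" for j
    using that
  proof (induction j rule: dec_induct)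
    case (step j)
    then have "\<not> lucky_step j dvd Suc (pos (lucky_sieve j) n)"
      by (auto dest: dvd_imp_le)
    moreover have "Suc (pos (lucky_sieve (Suc j)) n) < lucky_step (Suc j)"
      using step lucky_step_less_Suc[of j] by (simp add: pos_lucky_sieve_Suc)
    ultimately show ?case
      using step by (simp add: lucky_sieve_Suc mem_remove_every_iff)
  qed (use assms in auto)
  have "n \<in> lucky_sieve j" for j
    using later[of "max i j"] lucky_sieve_antimono[of j "max i j"] by auto
  then show ?thesis
    by (simp add: lucky_numbers_def)
qed

lemma pos_lucky_sieve_1: "pos (lucky_sieve (Suc 0)) n = n div 2"
  by (induction n) (auto simp: lucky_sieve_1 pos_Suc)

lemma lucky_step_1: "lucky_step (Suc 0) = 3"
  unfolding lucky_step_Suc lucky_sieve_1 lucky_step_0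
  by (rule Least_equality) auto

lemma small_lucky_numbers: "{1, 3, 7} \<subseteq> lucky_numbers"
proof -
  have step: "lucky_step (Suc (Suc 0)) > 3"
    using lucky_step_less_Suc[of "Suc 0"] by (simp add: lucky_step_1)
  have "n \<in> lucky_sieve (Suc (Suc 0)) \<and> pos (lucky_sieve (Suc (Suc 0))) n \<le> 2"
    if "n \<in> {1, 3, 7}" for n
    unfolding lucky_sieve_Suc[of "Suc 0"] mem_remove_every_iff pos_remove_every
      pos_lucky_sieve_1 lucky_step_1
    using that by (auto simp: lucky_sieve_1 dvd_eq_mod_eq_0)
  then show ?thesis
    using step by (fastforce intro: lucky_if_pos_less_step)
qed

section \<open>Consecutive elements of a stage\<close>

lemma lucky_sieve_consecutive_le_double:
  assumes uv: "u \<in> lucky_sieve i" "v \<in> lucky_sieve i"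
    and m: "pos (lucky_sieve i) u = m" "pos (lucky_sieve i) v = Suc m" "m \<ge> 2"
  shows "v \<le> 2 * u"
proof -
  let ?a = "\<lambda>j. pos (lucky_sieve j) u" and ?b = "\<lambda>j. pos (lucky_sieve j) v"
  have undo: "?a j = ?a (Suc j) + ?a (Suc j) div (lucky_step j - 1)"
    "?b j = ?b (Suc j) + ?b (Suc j) div (lucky_step j - 1)" if "j < i" for j
  proof -
    have "\<not> lucky_step j dvd Suc (?a j)" "\<not> lucky_step j dvd Suc (?b j)"
      using lucky_sieve_antimono[of "Suc j" i] uv that
      by (auto simp: lucky_sieve_Suc mem_remove_every_iff)
    then show "?a j = ?a (Suc j) + ?a (Suc j) div (lucky_step j - 1)"
      "?b j = ?b (Suc j) + ?b (Suc j) div (lucky_step j - 1)"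
      unfolding pos_lucky_sieve_Suc by (intro position_before_removal lucky_step_ge_2; simp)+
  qed
  \<comment> \<open>In the first alternative neither position has moved yet. In the second,
    \<open>c\<close> is large enough for \<open>double_bound_before_removal\<close> at every step
    still to be undone.\<close>
  define inv where "inv j \<longleftrightarrow> ?a j = m \<and> ?b j = Suc m \<or>
    (\<exists>c. ?b j + c \<le> 2 * ?a j \<and> (\<forall>k<j. lucky_step k \<le> c + 2))" for j
  have "inv 0"
  proof (rule inc_induct[of 0 i inv])
    show "inv i"
      using m by (simp add: inv_def)
  next
    fix j assume j: "0 \<le> j" "j < i" and IH: "inv (Suc j)"
    define s where "s = lucky_step j"
    have s2: "s \<ge> 2"
      using lucky_step_ge_2 by (simp add: s_def)
    have earlier: "lucky_step k < s" if "k < j" for k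
      using strict_mono_lucky_step that by (simp add: s_def strict_mono_def)
    have keep_bound: "?b j + c \<le> 2 * ?a j" if "s \<le> c + 2" "?b (Suc j) + c \<le> 2 * ?a (Suc j)" for c
      unfolding undo[OF j(2)] s_def[symmetric]
      by (rule double_bound_before_removal) (use s2 that in auto)
    from IH consider (late) "?a (Suc j) = m" "?b (Suc j) = Suc m"
      | (early) c where "?b (Suc j) + c \<le> 2 * ?a (Suc j)" "\<forall>k<Suc j. lucky_step k \<le> c + 2"
      unfolding inv_def by blast
    then show "inv j"
    proof cases
      case early
      then show ?thesis
        using keep_bound[of c] by (auto simp: inv_def s_def)
    next
      case late
      show ?thesis
      proof (cases "s \<le> Suc m")
        case True
        \<comment> \<open>\<open>m - 1\<close> is the largest \<open>c\<close> with
          \<open>Suc m + c \<le> 2 * m\<close>.\<close>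
        then have "?b j + (m - 1) \<le> 2 * ?a j"
          using keep_bound[of "m - 1"] late \<open>m \<ge> 2\<close> by simp
        moreover have "\<forall>k<j. lucky_step k \<le> m - 1 + 2"
          using earlier True by fastforce
        ultimately show ?thesis
          unfolding inv_def by blast
      next
        case False
        then have "m div (s - 1) = 0"
          by simp
        then have a: "?a j = m"
          using undo(1)[OF j(2)] late by (simp add: s_def)
        show ?thesis
        proof (cases "s = m + 2")
          case True
          \<comment> \<open>Only the position of \<open>v\<close> moves, by one, which lowers
            \<open>c\<close> to \<open>m - 2\<close>.\<close>
          then have "?b j = m + 2"
            using undo(2)[OF j(2)] late by (simp flip: s_def)
          \<comment> \<open>The bound needed is \<open>c + 2 = m\<close>. Parity excludes the value
            \<open>m + 1\<close>; the even step 2 is covered by \<open>m \<ge> 2\<close>.\<close>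
          moreover have "lucky_step k \<le> m" if "k < j" for k
          proof (cases "k = 0")
            case False
            then have "odd (lucky_step k)" "odd s"
              using odd_lucky_step that by (auto simp: s_def)
            moreover have "lucky_step k < m + 2"
              using earlier[OF that] True by simp
            ultimately show ?thesis
              using True by (cases "lucky_step k = Suc m") auto
          qed (use \<open>m \<ge> 2\<close> lucky_step_0 in simp)
          ultimately show ?thesis
            using a le_add_diff_inverse2[OF \<open>m \<ge> 2\<close>] unfolding inv_def
            by (intro disjI2 exI[of _ "m - 2"] conjI) (simp, metis)
        next
          case False
          with \<open>\<not> s \<le> Suc m\<close> have "Suc m div (s - 1) = 0"
            by simp
          then show ?thesis
            using undo(2)[OF j(2)] late a by (simp add: s_def inv_def)
        qed
      qed
    qed
  qed simp
  moreover have "u > 0" "v > 0"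
    using uv lucky_sieve_antimono[of 0 i] by (auto simp: lucky_sieve_0)
  ultimately show ?thesis
    by (auto simp: inv_def lucky_sieve_0 pos_atLeast_1)
qed

theorem theorem4p1:
  fixes x :: real
  assumes "x \<ge> 4"
  shows "\<exists>n\<in>lucky_numbers. real n \<in> {x..2 * x}"
proof (cases "x \<le> 7")
  case True
  then show ?thesis
    using small_lucky_numbers assms by (intro bexI[of _ 7]) auto
next
  case False
  \<comment> \<open>As \<open>lucky_step i \<ge> i \<ge> 2 * x\<close>, every element of stage
    \<open>i\<close> below \<open>2 * x\<close> is lucky.\<close>
  define i where "i = nat \<lceil>2 * x\<rceil>"
  have i: "2 * x \<le> real i"
    unfolding i_def by (rule real_nat_ceiling_ge)
  have step: "i \<le> lucky_step i"
    using strict_mono_lucky_step by (rule strict_mono_imp_increasing)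
  let ?A = "lucky_sieve i"
  have in_A: "1 \<in> ?A" "3 \<in> ?A" "7 \<in> ?A"
    using small_lucky_numbers by (auto simp: lucky_numbers_def)
  define v where "v = (LEAST n. n \<in> ?A \<and> x \<le> real n)"
  obtain n where "n \<in> ?A" "nat \<lceil>x\<rceil> < n"
    using lucky_sieve_unbounded by blast
  then have "n \<in> ?A \<and> x \<le> real n"
    by linarith
  then have v: "v \<in> ?A" "x \<le> real v"
    unfolding v_def by (metis (mono_tags, lifting) LeastI)+
  have v_least: "real w < x" if "w \<in> ?A" "w < v" for w
    using not_less_Least[of w "\<lambda>n. n \<in> ?A \<and> x \<le> real n"] that unfolding v_def by auto
  \<comment> \<open>The predecessor of \<open>v\<close> in \<open>?A\<close> lies below
    \<open>x\<close>, so \<open>v \<le> 2 * u\<close> will yield \<open>v < 2 * x\<close>.\<close>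
  define u where "u = Max {w \<in> ?A. w < v}"
  have "7 < v"
    using False v by linarith
  then have "u \<in> {w \<in> ?A. w < v}"
    unfolding u_def using in_A by (intro Max_in) auto
  then have u: "u \<in> ?A" "u < v"
    by auto
  have u_max: "w \<le> u" if "w \<in> ?A" "w < v" for w
    unfolding u_def using that by (intro Max_ge) auto
  \<comment> \<open>Since \<open>7 \<le> u\<close>, both 1 and 3 precede \<open>u\<close>, which
    gives the position of at least 2 required for consecutive elements.\<close>
  have "card {1, 3 :: nat} \<le> pos ?A u"
    unfolding pos_def using in_A u_max[of 7] \<open>7 < v\<close> by (intro card_mono) auto
  then have "v \<le> 2 * u"
    using lucky_sieve_consecutive_le_double[OF u(1) v(1) refl] pos_next[OF u u_max] by simp
  moreover have "real u < x"
    using v_least u by simp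
  ultimately have "real v < 2 * x"
    by linarith
  moreover have "v \<in> lucky_numbers"
  proof (rule lucky_if_pos_less_step[OF v(1)])
    have "v < i"
      using \<open>real v < 2 * x\<close> i by linarith
    then show "Suc (pos ?A v) < lucky_step i"
      using pos_lucky_sieve_le[of i v] step \<open>7 < v\<close> by linarith
  qed
  ultimately show ?thesis
    using v by (intro bexI[of _ v]) auto
qed

end
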